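(* For every standard formula $\alpha$ and all formulas $\phi,\psi$ of the team language, the formula $(\alpha\to\phi\veebar\psi)\to(\alpha\to\phi)\veebar(\alpha\to\psi)$ is valid on every distributive general intuitionistic team Kripke frame.
   Context: **Language.** Fix a set $\mathsf{Prop}$ of propositional variables. Formulas of the team language are $\phi::=p\mid\bot\mid\phi\wedge\phi\mid\phi\vee\phi\mid\phi\veebar\phi\mid\phi\to\phi$; $\vee$ is the local and $\veebar$ the global disjunction; both bind more strongly than $\to$. Formulas without $\veebar$ are standard. **Frames.** For a nonempty set $W$ with a partial order $R$, teams are sets $t\subseteq W$; $R[t]=\{v\mid\exists w\in t:\ wRv\}$; and $tR^\circ s$ iff $\forall w\in t\,\exists v\in s\,(wRv)$ and $\forall v\in s\,\exists w\in t\,(wRv)$. A general intuitionistic team Kripke frame is $(W,R,\succcurlyeq,\Cup)$ where $W\neq\varnothing$, $R$ is a partial order on $W$, $\Cup$ is a binary operation on $\wp(W)$ such that $(\wp(W),\Cup,\varnothing)$ is a bounded join-semilattice ($\Cup$ associative, commutative, idempotent, $\varnothing\Cup t=t$), $\preccurlyeq$ is the induced partial order ($t\preccurlyeq s$ iff $t\Cup s=s$) with converse $\succcurlyeq$, and for all $t,s,s'\subseteq W$: - (a) if $tR^\circ s$ and $s\succcurlyeq s'$, then there is $t'\subseteq W$ with $t\succcurlyeq t'$ and $t'R^\circ s'$; - (b) $t\succcurlyeq\circ R^\circ s$ implies $R[t]\succcurlyeq s$, where $t\succcurlyeq\circ R^\circ s$ means there is $r\subseteq W$ with $t\succcurlyeq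 r$ and $rR^\circ s$; - (c) $R[t]\Cup R[s]=R[t\Cup s]$. The frame is distributive if for all $t,r,s\subseteq W$, $t\preccurlyeq r\Cup s$ implies that there are $r',s'\subseteq W$ with $r'\preccurlyeq r$, $s'\preccurlyeq s$ and $t=r'\Cup s'$. A model on the frame adds a valuation $V:\mathsf{Prop}\to\wp(W)$ persistent w.r.t. $R$ ($w\in V(p)$, $wRv$ imply $v\in V(p)$). **Generalized team semantics:** - $\mathfrak{M},t\models p$ iff $t\preccurlyeq V(p)$; - $\mathfrak{M},t\models\bot$ iff $t=\varnothing$; - $\mathfrak{M},t\models\phi\wedge\psi$ iff $\mathfrak{M},t\models\phi$ and $\mathfrak{M},t\models\psi$; - $\mathfrak{M},t\models\phi\vee\psi$ iff there are $s,r\subseteq W$ with $t\preccurlyeq s\Cup r$, $\mathfrak{M},s\models\phi$ and $\mathfrak{M},r\models\psi$; - $\mathfrak{M},t\models\phi\veebar\psi$ iff $\mathfrak{M},t\models\phi$ or $\mathfrak{M},t\models\psi$; - $\mathfrak{M},t\models\phi\to\psi$ iff for all $s\subseteq W$ with $t\succcurlyeq\circ R^\circ s$, $\mathfrak{M},s\models\phi$ implies $\mathfrak{M},s\models\psi$. A formula is valid on a frame if it holds at all teams in all models on the frame. *)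

theory Defs
  imports Main
begin

datatype 'p fm =
    Atom 'p
  | Falsum  ("\<^bold>\<bottom>")
  | Conj "'p fm" "'p fm"  (infixr "\<^bold>\<and>" 65)
  | LDisj "'p fm" "'p fm"  (infixr "\<^bold>\<or>" 60)  \<comment> \<open>local disjunction\<close>
  | GDisj "'p fm" "'p fm"  (infixr "\<^bold>\<squnion>" 60)  \<comment> \<open>global disjunction\<close>
  | Imp "'p fm" "'p fm"  (infixr "\<^bold>\<rightarrow>" 55)

primrec standard :: "'p fm \<Rightarrow> bool" where
  "standard (Atom p) = True"
| "standard \<^bold>\<bottom> = True"
| "standard (\<phi> \<^bold>\<and> \<psi>) = (standard \<phi> \<and> standard \<psi>)"
| "standard (\<phi> \<^bold>\<or> \<psi>) = (standard \<phi> \<and> standard \<psi>)"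
| "standard (\<phi> \<^bold>\<squnion> \<psi>) = False"
| "standard (\<phi> \<^bold>\<rightarrow> \<psi>) = (standard \<phi> \<and> standard \<psi>)"

text \<open>
  Only the values of \<open>join\<close> on subsets of \<open>worlds\<close> matter. The order component of a frame is not
  stored, since it is determined by \<open>join\<close>.
\<close>

record 'w team_frame =
  worlds :: "'w set"
  acc :: "('w \<times> 'w) set"
  join :: "'w set \<Rightarrow> 'w set \<Rightarrow> 'w set"

definition team_le :: "'w team_frame \<Rightarrow> 'w set \<Rightarrow> 'w set \<Rightarrow> bool" where
  "team_le F t s \<longleftrightarrow> join F t s = s"

definition lift_acc :: "'w team_frame \<Rightarrow> 'w set \<Rightarrow> 'w set \<Rightarrow> bool" where
  "lift_acc F t s \<longleftrightarrow>
     (\<forall>w\<in>t. \<exists>v\<in>s. (w, v) \<in> acc F) \<and> (\<forall>v\<in>s. \<exists>w\<in>t. (w, v) \<in> acc F)"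

text \<open>This is \<open>t \<succcurlyeq>\<circ>R\<degree> s\<close>, where \<open>R\<degree>\<close> is \<^const>\<open>lift_acc\<close>.\<close>

definition reach :: "'w team_frame \<Rightarrow> 'w set \<Rightarrow> 'w set \<Rightarrow> bool" where
  "reach F t s \<longleftrightarrow> (\<exists>r\<subseteq>worlds F. team_le F r t \<and> lift_acc F r s)"

definition bounded_join_semilattice :: "'w team_frame \<Rightarrow> bool" where
  "bounded_join_semilattice F \<longleftrightarrow>
     (\<forall>t\<subseteq>worlds F. \<forall>s\<subseteq>worlds F. join F t s \<subseteq> worlds F) \<and>
     (\<forall>t\<subseteq>worlds F. \<forall>s\<subseteq>worlds F. \<forall>r\<subseteq>worlds F.
        join F (join F t s) r = join F t (join F s r)) \<and>
     (\<forall>t\<subseteq>worlds F. \<forall>s\<subseteq>worlds F. join F t s = join F s t) \<and>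
     (\<forall>t\<subseteq>worlds F. join F t t = t) \<and>
     (\<forall>t\<subseteq>worlds F. join F {} t = t)"

definition int_team_frame :: "'w team_frame \<Rightarrow> bool" where
  "int_team_frame F \<longleftrightarrow>
     worlds F \<noteq> {} \<and>
     partial_order_on (worlds F) (acc F) \<and>
     bounded_join_semilattice F \<and>
     (\<forall>t\<subseteq>worlds F. \<forall>s\<subseteq>worlds F. \<forall>s'\<subseteq>worlds F.
        lift_acc F t s \<and> team_le F s' s \<longrightarrow>
        (\<exists>t'\<subseteq>worlds F. team_le F t' t \<and> lift_acc F t' s')) \<and>
     (\<forall>t\<subseteq>worlds F. \<forall>s\<subseteq>worlds F. reach F t s \<longrightarrow> team_le F s (acc F `` t)) \<and>
     (\<forall>t\<subseteq>worlds F. \<forall>s\<subseteq>worlds F.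
        join F (acc F `` t) (acc F `` s) = acc F `` (join F t s))"

definition distributive :: "'w team_frame \<Rightarrow> bool" where
  "distributive F \<longleftrightarrow>
     (\<forall>t\<subseteq>worlds F. \<forall>r\<subseteq>worlds F. \<forall>s\<subseteq>worlds F.
        team_le F t (join F r s) \<longrightarrow>
        (\<exists>r'\<subseteq>worlds F. \<exists>s'\<subseteq>worlds F. team_le F r' r \<and> team_le F s' s \<and> t = join F r' s'))"

definition persistent_valuation :: "'w team_frame \<Rightarrow> ('p \<Rightarrow> 'w set) \<Rightarrow> bool" where
  "persistent_valuation F V \<longleftrightarrow>
     (\<forall>p. V p \<subseteq> worlds F) \<and> (\<forall>p w v. w \<in> V p \<and> (w, v) \<in> acc F \<longrightarrow> v \<in> V p)"

primrec sat :: "'w team_frame \<Rightarrow> ('p \<Rightarrow> 'w set) \<Rightarrow> 'w set \<Rightarrow> 'p fm \<Rightarrow> bool" where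
  "sat F V t (Atom p) \<longleftrightarrow> team_le F t (V p)"
| "sat F V t \<^bold>\<bottom> \<longleftrightarrow> t = {}"
| "sat F V t (\<phi> \<^bold>\<and> \<psi>) \<longleftrightarrow> sat F V t \<phi> \<and> sat F V t \<psi>"
| "sat F V t (\<phi> \<^bold>\<or> \<psi>) \<longleftrightarrow>
     (\<exists>s\<subseteq>worlds F. \<exists>r\<subseteq>worlds F. team_le F t (join F s r) \<and> sat F V s \<phi> \<and> sat F V r \<psi>)"
| "sat F V t (\<phi> \<^bold>\<squnion> \<psi>) \<longleftrightarrow> sat F V t \<phi> \<or> sat F V t \<psi>"
| "sat F V t (\<phi> \<^bold>\<rightarrow> \<psi>) \<longleftrightarrow>
     (\<forall>s\<subseteq>worlds F. reach F t s \<longrightarrow> sat F V s \<phi> \<longrightarrow> sat F V s \<psi>)"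

definition valid_on :: "'w team_frame \<Rightarrow> 'p fm \<Rightarrow> bool" where
  "valid_on F \<phi> \<longleftrightarrow>
     (\<forall>V. persistent_valuation F V \<longrightarrow> (\<forall>t\<subseteq>worlds F. sat F V t \<phi>))"

end

theory Submission
  imports Defs
begin

text \<open>
  Conditions (a) and (b) make reachability from \<open>t\<close> the same as lying below \<open>R[t]\<close>, so the teams
  reachable from \<open>t\<close> are closed under joins. Satisfaction is inherited by smaller teams, and on
  distributive frames standard formulas are also preserved by joins. Hence if
  \<open>s\<^sub>1\<close> and \<open>s\<^sub>2\<close> refuted \<open>\<alpha> \<rightarrow> \<phi>\<close> and \<open>\<alpha> \<rightarrow> \<psi>\<close> at \<open>t\<close>, their join would be a reachable team
  satisfying \<open>\<alpha>\<close> but neither \<open>\<phi>\<close> nor \<open>\<psi>\<close>.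
\<close>

locale team_frame_on =
  fixes F :: "'w team_frame"
  assumes frame: "int_team_frame F"
begin

lemma acc_subset: "acc F \<subseteq> worlds F \<times> worlds F"
  and acc_refl: "w \<in> worlds F \<Longrightarrow> (w, w) \<in> acc F"
  using frame
  by (auto simp: int_team_frame_def partial_order_on_def preorder_on_def refl_on_def)

lemma Image_acc_subset: "acc F `` t \<subseteq> worlds F"
  using acc_subset by blast

lemma semilattice: "bounded_join_semilattice F"
  using frame by (simp add: int_team_frame_def)

lemma join_closed: "t \<subseteq> worlds F \<Longrightarrow> s \<subseteq> worlds F \<Longrightarrow> join F t s \<subseteq> worlds F"
  and join_commute: "t \<subseteq> worlds F \<Longrightarrow> s \<subseteq> worlds F \<Longrightarrow> join F t s = join F s t"
  and join_idem: "t \<subseteq> worlds F \<Longrightarrow> join F t t = t"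
  and join_empty_left: "t \<subseteq> worlds F \<Longrightarrow> join F {} t = t"
  using semilattice by (simp_all add: bounded_join_semilattice_def)

lemma join_assoc:
  assumes "t \<subseteq> worlds F" "s \<subseteq> worlds F" "r \<subseteq> worlds F"
  shows "join F (join F t s) r = join F t (join F s r)"
proof -
  have "\<forall>t\<subseteq>worlds F. \<forall>s\<subseteq>worlds F. \<forall>r\<subseteq>worlds F.
      join F (join F t s) r = join F t (join F s r)"
    using semilattice unfolding bounded_join_semilattice_def by (elim conjE)
  then show ?thesis using assms by simp
qed

lemma team_le_refl: "t \<subseteq> worlds F \<Longrightarrow> team_le F t t"
  by (simp add: team_le_def join_idem)

lemma team_le_trans:
  assumes "t \<subseteq> worlds F" "s \<subseteq> worlds F" "r \<subseteq> worlds F" "team_le F t s" "team_le F s r"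
  shows "team_le F t r"
  using assms by (metis join_assoc team_le_def)

lemma team_le_join1:
  assumes "t \<subseteq> worlds F" "s \<subseteq> worlds F"
  shows "team_le F t (join F t s)"
  using assms by (metis join_assoc join_idem team_le_def)

lemma team_le_join2:
  assumes "t \<subseteq> worlds F" "s \<subseteq> worlds F"
  shows "team_le F s (join F t s)"
  using assms by (metis join_commute team_le_join1)

lemma join_least:
  assumes "t \<subseteq> worlds F" "s \<subseteq> worlds F" "r \<subseteq> worlds F" "team_le F t r" "team_le F s r"
  shows "team_le F (join F t s) r"
  using assms by (simp add: join_assoc team_le_def)

lemma join_mono:
  assumes "t \<subseteq> worlds F" "s \<subseteq> worlds F" "t' \<subseteq> worlds F" "s' \<subseteq> worlds F"
    and "team_le F t t'" "team_le F s s'"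
  shows "team_le F (join F t s) (join F t' s')"
  using assms by (meson join_closed join_least team_le_join1 team_le_join2 team_le_trans)

text \<open>The empty team is a unit on both sides by commutativity, so joining it to
  \<open>t\<close> returns \<open>t\<close> itself.\<close>

lemma team_le_empty: "t \<subseteq> worlds F \<Longrightarrow> team_le F t {} \<longleftrightarrow> t = {}"
  using join_commute[of t "{}"] join_empty_left[of t] by (simp add: team_le_def)

lemma lift_acc_Image:
  assumes "t \<subseteq> worlds F"
  shows "lift_acc F t (acc F `` t)"
  using assms acc_refl unfolding lift_acc_def by blast

text \<open>Left to right is condition (b). Conversely, reflexivity of \<open>acc F\<close> relates
  \<open>t\<close> to its image under \<open>lift_acc\<close>, and condition (a) then pulls any team
  below the image back to a team below \<open>t\<close>.\<close>

lemma reach_iff_team_le: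
  assumes "t \<subseteq> worlds F" "s \<subseteq> worlds F"
  shows "reach F t s \<longleftrightarrow> team_le F s (acc F `` t)"
proof
  show "reach F t s \<Longrightarrow> team_le F s (acc F `` t)"
    using frame assms by (simp add: int_team_frame_def)
next
  have "\<forall>t\<subseteq>worlds F. \<forall>s\<subseteq>worlds F. \<forall>s'\<subseteq>worlds F. lift_acc F t s \<and> team_le F s' s \<longrightarrow>
      (\<exists>t'\<subseteq>worlds F. team_le F t' t \<and> lift_acc F t' s')"
    using frame by (simp add: int_team_frame_def)
  then show "team_le F s (acc F `` t) \<Longrightarrow> reach F t s"
    using assms lift_acc_Image[of t] Image_acc_subset[of t] unfolding reach_def by blast
qed

lemma reach_join:
  assumes "t \<subseteq> worlds F" "s \<subseteq> worlds F" "r \<subseteq> worlds F" "reach F t s" "reach F t r"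
  shows "reach F t (join F s r)"
  using assms by (simp add: reach_iff_team_le join_closed join_least Image_acc_subset)

text \<open>The intermediate team that witnesses reachability from \<open>t'\<close> also lies below
  \<open>t\<close>.\<close>

lemma reach_mono:
  assumes "t \<subseteq> worlds F" "t' \<subseteq> worlds F" "team_le F t' t" "reach F t' s"
  shows "reach F t s"
  using assms unfolding reach_def by (blast intro: team_le_trans)

lemma Image_acc_join:
  assumes "t \<subseteq> worlds F" "s \<subseteq> worlds F"
  shows "acc F `` join F t s = join F (acc F `` t) (acc F `` s)"
  using frame assms by (simp add: int_team_frame_def)

text \<open>Atoms and local disjunctions only bound the team from above, so transitivity suffices
  and the witnesses of a disjunction can be kept. For an implication, the smaller team reaches no
  team that the larger one does not.\<close>

lemma sat_downward:
  assumes "persistent_valuation F V"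
    and "t \<subseteq> worlds F" "t' \<subseteq> worlds F" "team_le F t' t" "sat F V t \<phi>"
  shows "sat F V t' \<phi>"
  using assms(2-)
proof (induction \<phi> arbitrary: t t')
  case (Atom p)
  then show ?case
    using assms(1) team_le_trans[of t' t "V p"] by (simp add: persistent_valuation_def)
next
  case Falsum
  then show ?case by (simp add: team_le_empty)
next
  case (LDisj \<phi> \<psi>)
  then obtain s r where "s \<subseteq> worlds F" "r \<subseteq> worlds F" "team_le F t (join F s r)"
    "sat F V s \<phi>" "sat F V r \<psi>"
    by auto
  moreover from this have "team_le F t' (join F s r)"
    using LDisj.prems join_closed team_le_trans[of t' t "join F s r"] by simp
  ultimately show ?case by auto
next
  case (Imp \<phi> \<psi>)
  then show ?case using reach_mono by (metis sat.simps(6))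
qed auto

text \<open>Standardness rules out the global disjunction, where the two teams may satisfy different
  disjuncts. Atoms ask for a fixed upper bound, which joins respect; distributivity enters at
  implications.\<close>

lemma sat_join:
  assumes "distributive F" "persistent_valuation F V" "standard \<alpha>"
    and "t \<subseteq> worlds F" "s \<subseteq> worlds F" "sat F V t \<alpha>" "sat F V s \<alpha>"
  shows "sat F V (join F t s) \<alpha>"
  using assms(3-)
proof (induction \<alpha> arbitrary: t s)
  case (Atom p)
  then show ?case
    using assms(2) by (simp add: persistent_valuation_def join_least)
next
  case Falsum
  then show ?case by (simp add: join_idem)
next
  case (LDisj \<alpha> \<beta>)
  then obtain t1 t2 s1 s2 where sub: "t1 \<subseteq> worlds F" "t2 \<subseteq> worlds F" "s1 \<subseteq> worlds F" "s2 \<subseteq> worlds F"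
    and le: "team_le F t (join F t1 t2)" "team_le F s (join F s1 s2)"
    and sat: "sat F V t1 \<alpha>" "sat F V t2 \<beta>" "sat F V s1 \<alpha>" "sat F V s2 \<beta>"
    by auto
  \<comment> \<open>The four witnesses are regrouped by disjunct, so that the induction hypotheses
    apply to each inner join.\<close>
  let ?u = "join F (join F t1 s1) (join F t2 s2)"
  have closed: "?u \<subseteq> worlds F" "join F t1 t2 \<subseteq> worlds F" "join F s1 s2 \<subseteq> worlds F"
    using sub by (simp_all add: join_closed)
  have "team_le F (join F t1 t2) ?u" "team_le F (join F s1 s2) ?u"
    using sub by (simp_all add: join_mono join_closed team_le_join1 team_le_join2)
  then have "team_le F t ?u" "team_le F s ?u"
    using LDisj.prems(2,3) closed le team_le_trans by blast+
  then have "team_le F (join F t s) ?u"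
    using LDisj.prems(2,3) closed(1) by (simp add: join_least)
  moreover have "sat F V (join F t1 s1) \<alpha>" "sat F V (join F t2 s2) \<beta>"
    using LDisj sub sat by simp_all
  ultimately show ?case
    using sub join_closed by (metis sat.simps(4))
next
  case (Imp \<alpha> \<beta>)
  have "sat F V r \<beta>" if r: "r \<subseteq> worlds F" "reach F (join F t s) r" "sat F V r \<alpha>" for r
  proof -
    \<comment> \<open>Condition (c) turns the image of the join into a join of images, so that
      distributivity can split \<open>r\<close> into a part reachable from \<open>t\<close> and a
      part reachable from \<open>s\<close>.\<close>
    have "team_le F r (join F (acc F `` t) (acc F `` s))"
      using Imp.prems(2,3) r(1,2) by (simp add: reach_iff_team_le join_closed Image_acc_join)
    then obtain r1 r2 where sub: "r1 \<subseteq> worlds F" "r2 \<subseteq> worlds F"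
      and le: "team_le F r1 (acc F `` t)" "team_le F r2 (acc F `` s)"
      and eq: "r = join F r1 r2"
      using assms(1) r(1) Image_acc_subset unfolding distributive_def by meson
    \<comment> \<open>Downward closure passes \<alpha> to both parts, the implications at
      \<open>t\<close> and \<open>s\<close> yield \<beta> there, and the induction hypothesis for
      \<beta> reassembles \<open>r\<close>.\<close>
    have "sat F V r1 \<alpha>" "sat F V r2 \<alpha>"
      using sat_downward[OF assms(2) r(1)] r(3) sub eq team_le_join1 team_le_join2 by auto
    then have "sat F V r1 \<beta>" "sat F V r2 \<beta>"
      using Imp.prems sub le by (simp_all add: reach_iff_team_le)
    then show ?thesis
      using Imp sub eq by simp
  qed
  then show ?case by simp
qed auto

end

theorem proposition4p30:
  fixes F :: "'w team_frame" and \<alpha> \<phi> \<psi> :: "'p fm"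
  assumes "int_team_frame F"
    and "distributive F"
    and "standard \<alpha>"
  shows "valid_on F ((\<alpha> \<^bold>\<rightarrow> \<phi> \<^bold>\<squnion> \<psi>) \<^bold>\<rightarrow> (\<alpha> \<^bold>\<rightarrow> \<phi>) \<^bold>\<squnion> (\<alpha> \<^bold>\<rightarrow> \<psi>))"
proof -
  interpret team_frame_on F
    using assms(1) by unfold_locales
  have "sat F V t (\<alpha> \<^bold>\<rightarrow> \<phi>) \<or> sat F V t (\<alpha> \<^bold>\<rightarrow> \<psi>)"
    if V: "persistent_valuation F V" and t: "t \<subseteq> worlds F" "sat F V t (\<alpha> \<^bold>\<rightarrow> \<phi> \<^bold>\<squnion> \<psi>)" for V t
  proof (rule ccontr)
    assume "\<not> ?thesis"
    then obtain s1 s2 where sub: "s1 \<subseteq> worlds F" "s2 \<subseteq> worlds F"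
      and reach: "reach F t s1" "reach F t s2"
      and sat: "sat F V s1 \<alpha>" "\<not> sat F V s1 \<phi>" "sat F V s2 \<alpha>" "\<not> sat F V s2 \<psi>"
      by auto
    have closed: "join F s1 s2 \<subseteq> worlds F"
      using sub by (rule join_closed)
    moreover have "reach F t (join F s1 s2)"
      using t(1) sub reach by (rule reach_join)
    moreover have "sat F V (join F s1 s2) \<alpha>"
      using sat_join[OF assms(2) V assms(3)] sub sat by simp
    ultimately have "sat F V (join F s1 s2) \<phi> \<or> sat F V (join F s1 s2) \<psi>"
      using t(2) by auto
    \<comment> \<open>By downward closure, \<phi> at the join would hold at \<open>s1\<close>, and
      \<psi> at the join would hold at \<open>s2\<close>.\<close>
    then show False
      using sat_downward[OF V closed sub(1) team_le_join1[OF sub]]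
        sat_downward[OF V closed sub(2) team_le_join2[OF sub]] sat(2,4)
      by blast
  qed
  then show ?thesis
    by (simp add: valid_on_def)
qed

end
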